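(* Let $\mathcal{Y}$ be a normed space with a $C^{1,+}_{\mathrm{loc}}$-smooth LUR norm $\|\cdot\|$. Then the completion $\hat{\mathcal{Y}}$ of $\mathcal{Y}$ is super-reflexive.
   Context: All normed spaces are over the reals, and $\mathcal{Y}$ is infinite-dimensional (not assumed complete). A norm on $\mathcal{Y}$ is $C^{1,+}_{\mathrm{loc}}$-smooth if it is (Fréchet) differentiable with locally uniformly continuous derivative on the unit sphere $\mathcal{S}_{\mathcal{Y}}$, i.e. every point of $\mathcal{S}_{\mathcal{Y}}$ has a neighbourhood on which the derivative is uniformly continuous. The norm $\|\cdot\|$ is LUR (locally uniformly rotund) if for every $x\in\mathcal{S}_{\mathcal{Y}}$ and every sequence $(x_n)_{n\in\mathbb{N}}\subseteq\mathcal{S}_{\mathcal{Y}}$ with $\|x_n+x\|\to2$ one has $x_n\to x$. *)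

theory Defs
  imports "HOL-Analysis.Analysis"
begin

definition finite_dim :: "'a::real_vector set \<Rightarrow> bool" where
  "finite_dim F \<longleftrightarrow> (\<exists>B. finite B \<and> span B = F)"

(* D is the derivative x |-> norm'(x), as a map from the unit sphere to the dual space with
   its operator norm; neighbourhoods are taken relative to the sphere. Since the derivative of a
   norm is positively homogeneous of degree 0, neighbourhoods in the whole space (avoiding the
   origin) would give the same notion. *)
definition C1plus_loc_smooth_norm :: "'a::real_normed_vector itself \<Rightarrow> bool" where
  "C1plus_loc_smooth_norm _ \<longleftrightarrow>
     (\<exists>D :: 'a \<Rightarrow> 'a \<Rightarrow>\<^sub>L real.
        (\<forall>x \<in> sphere 0 1. (norm has_derivative blinfun_apply (D x)) (at x)) \<and>
        (\<forall>x \<in> sphere 0 1. \<exists>U. open U \<and> x \<in> U \<and> uniformly_continuous_on (U \<inter> sphere 0 1) D))"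

definition LUR_norm :: "'a::real_normed_vector itself \<Rightarrow> bool" where
  "LUR_norm _ \<longleftrightarrow>
     (\<forall>x \<in> sphere (0::'a) 1. \<forall>X :: nat \<Rightarrow> 'a.
        (\<forall>n. X n \<in> sphere 0 1) \<and> (\<lambda>n. norm (X n + x)) \<longlonglongrightarrow> 2 \<longrightarrow> X \<longlonglongrightarrow> x)"

(* The Banach space 'b together with the map j is a completion of the normed space 'a. *)
definition is_completion :: "('a::real_normed_vector \<Rightarrow> 'b::banach) \<Rightarrow> bool" where
  "is_completion j \<longleftrightarrow>
     linear j \<and> (\<forall>x. norm (j x) = norm x) \<and> closure (range j) = UNIV"

lift_definition canonical_embedding ::
  "'a::real_normed_vector \<Rightarrow> ('a \<Rightarrow>\<^sub>L real) \<Rightarrow>\<^sub>L real" is "\<lambda>x f. blinfun_apply f x"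
  by (rule blinfun.bounded_linear_left)

definition reflexive :: "'a::banach itself \<Rightarrow> bool" where
  "reflexive _ \<longleftrightarrow> surj (canonical_embedding :: 'a \<Rightarrow> ('a \<Rightarrow>\<^sub>L real) \<Rightarrow>\<^sub>L real)"

(* T is only required to be linear on F; its values outside F are irrelevant. *)
definition finitely_representable ::
  "'c::real_normed_vector itself \<Rightarrow> 'b::real_normed_vector itself \<Rightarrow> bool" where
  "finitely_representable _ _ \<longleftrightarrow>
     (\<forall>F :: 'c set. \<forall>\<epsilon>::real. finite_dim F \<and> \<epsilon> > 0 \<longrightarrow>
        (\<exists>T :: 'c \<Rightarrow> 'b.
           (\<forall>x\<in>F. \<forall>y\<in>F. T (x + y) = T x + T y) \<and>
           (\<forall>r. \<forall>x\<in>F. T (r *\<^sub>R x) = r *\<^sub>R T x) \<and>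
           (\<forall>x\<in>F. norm x / (1 + \<epsilon>) \<le> norm (T x) \<and> norm (T x) \<le> (1 + \<epsilon>) * norm x)))"

(* A Banach space 'b is super-reflexive if every Banach space finitely representable in 'b is
   reflexive. HOL cannot quantify over types inside a definition, so a theorem asserting that 'b is
   super-reflexive takes the form
     finitely_representable TYPE('c) TYPE('b) ==> reflexive TYPE('c)
   with 'c::banach a type variable occurring nowhere else in it. *)

end

theory Submission
  imports Defs
begin

text \<open>Write \<open>Y\<close> for the smooth space. The proof never renorms \<open>Y\<close>: it exhibits a small ball of the
  dual \<open>Y*\<close> on which the dual norm is uniformly convex, and shows that this alone excludes long James
  systems, that is, finite sequences of bounded functionals \<open>g i\<close> and bounded vectors \<open>x k\<close> for which
  \<open>g i (x k)\<close> is at least \<open>b\<close> for \<open>i \<le> k\<close> and at most \<open>a < b\<close> for \<open>k < i\<close>.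

  Local uniform convexity (lemma dual_norm_uniformly_convex_near). Fix a unit vector \<open>x\<close> with derivative
  \<open>f\<close>. By LUR, the slices of the sphere cut off by \<open>f\<close> shrink to \<open>x\<close>, so one of them lies where the
  derivative is uniformly continuous, and there the norm is uniformly smooth. A functional close to
  \<open>f\<close> almost attains its norm at a point of that slice. The duality argument of Smulian, run at such
  points only, gives: if \<open>g\<close> and \<open>h\<close> have norm at most \<open>R\<close>, are \<open>\<epsilon>\<close> apart and have a midpoint close
  to \<open>f\<close>, then the midpoint has norm at most \<open>R - \<delta>\<close>, with \<open>\<delta>\<close> depending on \<open>\<epsilon>\<close> alone.

  No long James systems (lemma james_systems_bounded_length). A James system can be scaled and
  translated into the small ball around \<open>f\<close>. The means over two adjacent blocks of functionals are
  separated by a vector of the system, so each doubling of the block length lowers the norm of the means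
  by a fixed \<open>\<delta>\<close>. But all means stay in the small ball, where the norm is close to 1.

  Non-reflexive spaces have long James systems (lemma nonreflexive_james_systems). This is an argument
  of James: a bidual element \<open>F\<close> at positive distance from the space lets one choose functionals and
  vectors alternately, each time by Helly's theorem. Finally, James systems pass from a space to any
  space in which it is finitely representable, and from a completion to the dense subspace (lemma
  james_system_transfer); functionals are carried over by the Hahn-Banach theorem.\<close>

section \<open>The Hahn-Banach theorem\<close>

definition sublinear :: "('a::real_vector \<Rightarrow> real) \<Rightarrow> bool" where
  "sublinear p \<longleftrightarrow>
     (\<forall>x y. p (x + y) \<le> p x + p y) \<and> (\<forall>s\<ge>0. \<forall>x. p (s *\<^sub>R x) = s * p x)"

lemma sublinear_add: "sublinear p \<Longrightarrow> p (x + y) \<le> p x + p y"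
  and sublinear_scale: "sublinear p \<Longrightarrow> 0 \<le> s \<Longrightarrow> p (s *\<^sub>R x) = s * p x"
  by (auto simp: sublinear_def)

lemma sublinear_zero: "sublinear p \<Longrightarrow> p 0 = 0"
  using sublinear_scale[of p 0 0] by simp

lemma sublinear_minus: "sublinear p \<Longrightarrow> - p (- x) \<le> p x"
  using sublinear_add[of p x "- x"] sublinear_zero[of p] by simp

lemma sublinearI:
  assumes add: "\<And>x y. p (x + y) \<le> p x + p y"
    and scale: "\<And>s x. 0 < s \<Longrightarrow> p (s *\<^sub>R x) \<le> s * p x"
    and zero: "p 0 = 0"
  shows "sublinear p"
proof -
  have "p (s *\<^sub>R x) = s * p x" if "0 < s" for s x
  proof (rule antisym)
    have "p (inverse s *\<^sub>R (s *\<^sub>R x)) \<le> inverse s * p (s *\<^sub>R x)"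
      by (rule scale) (use that in simp)
    then show "s * p x \<le> p (s *\<^sub>R x)"
      using that by (simp add: field_simps)
  qed (rule scale[OF that])
  then have "p (s *\<^sub>R x) = s * p x" if "0 \<le> s" for s x
    using that zero by (cases "s = 0") auto
  then show ?thesis
    using add by (auto simp: sublinear_def)
qed

text \<open>The function below is the infimal convolution of \<open>p\<close> with the cone \<open>A\<close>. The positivity
  hypothesis is what keeps the infimum finite, and evaluating at the members \<open>0\<close> and \<open>(z, t)\<close> of \<open>A\<close>
  gives the two bounds. It serves twice: to impose the linear constraints of the Hahn-Banach
  theorem, and to show that minimal sublinear functionals are odd.\<close>
lemma sublinear_below_cone:
  assumes p: "sublinear p" and A: "convex_cone A"
    and pos: "\<And>z t. (z, t) \<in> A \<Longrightarrow> 0 \<le> p (- z) + t"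
  obtains u where "sublinear u" "\<And>y. u y \<le> p y" "\<And>z t. (z, t) \<in> A \<Longrightarrow> u z \<le> t"
proof -
  define u where "u y = (INF a\<in>A. p (y - fst a) + snd a)" for y
  have lower: "- p (- y) \<le> p (y - fst a) + snd a" if "a \<in> A" for y a
    using sublinear_add[OF p, of "- y" "y - fst a"] pos[of "fst a" "snd a"] that by simp
  then have bdd: "bdd_below ((\<lambda>a. p (y - fst a) + snd a) ` A)" for y
    by (auto intro!: bdd_belowI)
  have zA: "0 \<in> A" and addA: "\<And>a b. a \<in> A \<Longrightarrow> b \<in> A \<Longrightarrow> a + b \<in> A"
    and scaleA: "\<And>a s. a \<in> A \<Longrightarrow> 0 < s \<Longrightarrow> s *\<^sub>R a \<in> A"
    using A by (auto simp: convex_cone_iff)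
  have le: "u y \<le> p (y - fst a) + snd a" if "a \<in> A" for y a
    unfolding u_def by (rule cINF_lower[OF bdd that])
  have ge: "m \<le> u y" if "\<And>a. a \<in> A \<Longrightarrow> m \<le> p (y - fst a) + snd a" for m y
    unfolding u_def using zA that by (intro cINF_greatest) auto
  have "sublinear u"
  proof (rule sublinearI)
    show "u (x + y) \<le> u x + u y" for x y
    proof -
      have *: "u (x + y) \<le> (p (x - fst a) + snd a) + (p (y - fst b) + snd b)"
        if "a \<in> A" "b \<in> A" for a b
        using le[OF addA[OF that], of "x + y"] sublinear_add[OF p, of "x - fst a" "y - fst b"]
        by (simp add: algebra_simps)
      have "u (x + y) - (p (x - fst a) + snd a) \<le> u y" if "a \<in> A" for a
        using * that by (intro ge) (fastforce simp: algebra_simps)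
      then have "u (x + y) - u y \<le> u x"
        by (intro ge) (fastforce simp: algebra_simps)
      then show ?thesis by simp
    qed
  next
    fix s :: real and x
    assume s: "0 < s"
    have "u (s *\<^sub>R x) / s \<le> u x"
    proof (rule ge)
      fix a assume a: "a \<in> A"
      have "u (s *\<^sub>R x) \<le> p (s *\<^sub>R (x - fst a)) + s * snd a"
        using le[OF scaleA[OF a s], of "s *\<^sub>R x"] by (simp add: scaleR_diff_right)
      then show "u (s *\<^sub>R x) / s \<le> p (x - fst a) + snd a"
        using s sublinear_scale[OF p, of s "x - fst a"] by (simp add: divide_le_eq algebra_simps)
    qed
    then show "u (s *\<^sub>R x) \<le> s * u x"
      using s by (simp add: field_simps)
  next
    show "u 0 = 0"
      using le[OF zA, of 0] ge[of 0 0] lower[of _ 0] sublinear_zero[OF p] by fastforce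
  qed
  moreover have "u y \<le> p y" for y
    using le[OF zA, of y] by simp
  moreover have "u z \<le> t" if "(z, t) \<in> A" for z t
    using le[OF that, of z] sublinear_zero[OF p] by simp
  ultimately show ?thesis by (rule that)
qed

text \<open>Zorn's lemma applies because the pointwise infimum over a chain is again sublinear: of two
  members of the chain, the smaller one bounds both summands in the subadditivity estimate. The
  bound \<open>- p (- x) \<le> q x\<close> keeps the infima finite.\<close>
lemma minimal_sublinear_below:
  assumes p: "sublinear p"
  obtains q where "sublinear q" "\<And>x. q x \<le> p x"
    "\<And>r. sublinear r \<Longrightarrow> (\<And>x. r x \<le> q x) \<Longrightarrow> r = q"
proof -
  define S where "S = {q. sublinear q \<and> (\<forall>x. q x \<le> p x)}"
  define above where "above q r \<longleftrightarrow> (\<forall>x. r x \<le> q x)" for q r :: "'a \<Rightarrow> real"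
  have "\<exists>m\<in>S. \<forall>a\<in>S. above m a \<longrightarrow> a = m"
  proof (rule predicate_Zorn)
    show "partial_order_on S (relation_of above S)"
      unfolding partial_order_on_def preorder_on_def refl_on_def trans_def antisym_def
        relation_of_def above_def
      by (auto intro: order_trans intro!: ext antisym)
  next
    fix C assume C: "C \<in> Chains (relation_of above S)"
    have CS: "q \<in> S" if "q \<in> C" for q
      using C that by (auto simp: Chains_def relation_of_def)
    have chain: "above q r \<or> above r q" if "q \<in> C" "r \<in> C" for q r
      using C that by (auto simp: Chains_def relation_of_def)
    show "\<exists>u\<in>S. \<forall>a\<in>C. above a u"
    proof (cases "C = {}")
      case True
      then show ?thesis using p by (auto simp: S_def)
    next
      case False
      define u where "u x = (INF q\<in>C. q x)" for x
      have sub: "sublinear q" and qp: "q x \<le> p x" if "q \<in> C" for q x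
        using CS[OF that] by (auto simp: S_def)
      have "- p (- x) \<le> q x" if "q \<in> C" for q x
        using sublinear_minus[OF sub[OF that], of x] qp[OF that, of "- x"] by simp
      then have bdd: "bdd_below ((\<lambda>q. q x) ` C)" for x
        by (auto intro!: bdd_belowI)
      have le: "u x \<le> q x" if "q \<in> C" for q x
        unfolding u_def by (rule cINF_lower[OF bdd that])
      have ge: "m \<le> u x" if "\<And>q. q \<in> C \<Longrightarrow> m \<le> q x" for m x
        unfolding u_def using False that by (intro cINF_greatest) auto
      have "sublinear u"
      proof (rule sublinearI)
        show "u (x + y) \<le> u x + u y" for x y
        proof -
          have *: "u (x + y) \<le> q x + r y" if "q \<in> C" "r \<in> C" for q r
            using chain[OF that] le[OF that(1), of "x + y"] le[OF that(2), of "x + y"]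
              sublinear_add[OF sub[OF that(1)], of x y] sublinear_add[OF sub[OF that(2)], of x y]
            unfolding above_def by (smt (verit))
          have "u (x + y) - q x \<le> u y" if "q \<in> C" for q
            using * that by (intro ge) (fastforce simp: algebra_simps)
          then have "u (x + y) - u y \<le> u x"
            by (intro ge) (fastforce simp: algebra_simps)
          then show ?thesis by simp
        qed
      next
        fix s :: real and x
        assume s: "0 < s"
        have "u (s *\<^sub>R x) / s \<le> u x"
          using le[of _ "s *\<^sub>R x"] s
          by (intro ge) (fastforce simp: sublinear_scale[OF sub] field_simps)
        then show "u (s *\<^sub>R x) \<le> s * u x"
          using s by (simp add: field_simps)
      next
        have "u 0 = (INF q\<in>C. 0)"
          unfolding u_def by (intro INF_cong refl) (simp add: sublinear_zero[OF sub])
        then show "u 0 = 0" using False by simp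
      qed
      moreover have "u x \<le> p x" for x
        using False le qp by (meson ex_in_conv order_trans)
      ultimately show ?thesis
        using le by (auto simp: S_def above_def)
    qed
  qed
  then obtain q where "q \<in> S" and min: "\<And>a. a \<in> S \<Longrightarrow> above q a \<Longrightarrow> a = q"
    by blast
  then have q: "sublinear q" "\<And>x. q x \<le> p x"
    by (auto simp: S_def)
  have "r = q" if "sublinear r" "\<And>x. r x \<le> q x" for r
    using that q(2) by (intro min) (auto simp: S_def above_def intro: order_trans)
  then show ?thesis
    using that q by blast
qed

text \<open>A minimal sublinear functional \<open>q\<close> is linear: pushing \<open>q\<close> below \<open>- q y\<close> at \<open>- y\<close> leaves it sublinear,
  so by minimality it was odd already, and an odd sublinear functional is linear.\<close>
lemma linear_below_sublinear:
  assumes p: "sublinear p"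
  obtains L where "linear L" "\<And>x. L x \<le> p x"
proof -
  obtain q where q: "sublinear q" and qp: "\<And>x. q x \<le> p x"
    and min: "\<And>r. sublinear r \<Longrightarrow> (\<And>x. r x \<le> q x) \<Longrightarrow> r = q"
    using minimal_sublinear_below[OF p] by blast
  have odd: "q (- y) = - q y" for y
  proof -
    let ?A = "(\<lambda>s. s *\<^sub>R (- y, - q y)) ` {0..}"
    have "convex_cone ?A"
      by (intro convex_cone_linear_image conjI linear_scaleR_left)
        (auto simp: convex_cone_iff)
    then obtain u where u: "sublinear u" "\<And>x. u x \<le> q x"
      and uA: "\<And>z t. (z, t) \<in> ?A \<Longrightarrow> u z \<le> t"
      by (rule sublinear_below_cone[OF q]) (auto simp: sublinear_scale[OF q])
    have "u (- y) \<le> - q y"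
      by (rule uA) (auto intro!: image_eqI[of _ _ 1])
    then have "q (- y) \<le> - q y"
      using min[OF u] by simp
    then show ?thesis
      using sublinear_minus[OF q, of "- y"] by simp
  qed
  have add: "q (x + y) = q x + q y" for x y
    using sublinear_add[OF q, of x y] sublinear_add[OF q, of "x + y" "- y"] odd[of y] by simp
  have scale: "q (s *\<^sub>R x) = s * q x" for s x
  proof (cases "0 \<le> s")
    case False
    then have "q (- (- s *\<^sub>R x)) = s * q x"
      unfolding odd using sublinear_scale[OF q, of "- s" x] by simp
    then show ?thesis by simp
  qed (rule sublinear_scale[OF q])
  have "linear q"
    by (intro linearI) (simp_all add: add scale)
  then show ?thesis
    using qp that by blast
qed

text \<open>The Hahn-Banach theorem with the values of the functional prescribed by a cone of inequalities.
  Taking for the cone the graph of a linear functional on a subspace gives the extension theorem.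
  In this form the prescribed values may be indexed by another space, which suits
  functionals that are pulled back along an operator.\<close>
theorem hahn_banach_cone:
  fixes A :: "('a::real_normed_vector \<times> real) set"
  assumes C: "0 \<le> C" and A: "convex_cone A"
    and pos: "\<And>z t. (z, t) \<in> A \<Longrightarrow> 0 \<le> C * norm z + t"
  obtains L :: "'a \<Rightarrow>\<^sub>L real" where "norm L \<le> C" "\<And>z t. (z, t) \<in> A \<Longrightarrow> L z \<le> t"
proof -
  have "sublinear (\<lambda>z::'a. C * norm z)"
    using C by (intro sublinearI)
      (auto simp: distrib_left[symmetric] norm_triangle_ineq intro: mult_left_mono)
  then obtain u where u: "sublinear u" "\<And>y. u y \<le> C * norm y"
      and uA: "\<And>z t. (z, t) \<in> A \<Longrightarrow> u z \<le> t"
    by (rule sublinear_below_cone[OF _ A]) (simp_all add: pos)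
  obtain L where L: "linear L" "\<And>x. L x \<le> u x"
    using linear_below_sublinear[OF u(1)] by blast
  have "L x \<le> C * norm x" for x
    using L(2)[of x] u(2)[of x] by linarith
  from this[of "- _"] this have bound: "norm (L x) \<le> C * norm x" for x
    using linear_neg[OF L(1), of x] by (smt (verit) norm_minus_cancel real_norm_def)
  have bl: "bounded_linear L"
    by (rule bounded_linear_intro[where K = C])
      (use bound in \<open>simp_all add: linear_add[OF L(1)] linear_scale[OF L(1)] mult.commute\<close>)
  show ?thesis
  proof (rule that[of "Blinfun L"])
    show "norm (Blinfun L) \<le> C"
      using C bound by (intro norm_blinfun_bound) (simp_all add: bounded_linear_Blinfun_apply[OF bl])
    show "Blinfun L z \<le> t" if "(z, t) \<in> A" for z t
      using uA[OF that] L(2)[of z] by (simp add: bounded_linear_Blinfun_apply[OF bl])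
  qed
qed

corollary norming_functional:
  fixes x :: "'a::real_normed_vector"
  obtains f :: "'a \<Rightarrow>\<^sub>L real" where "norm f \<le> 1" "f x = norm x"
proof -
  let ?A = "range (\<lambda>s. s *\<^sub>R (x, norm x))"
  have "convex_cone ?A"
    by (intro convex_cone_linear_image conjI linear_scaleR_left) (auto simp: convex_cone_iff)
  moreover have "0 \<le> 1 * norm z + t" if "(z, t) \<in> ?A" for z t
  proof -
    obtain s where "z = s *\<^sub>R x" "t = s * norm x"
      using \<open>(z, t) \<in> ?A\<close> by auto
    then have "1 * norm z + t = (\<bar>s\<bar> + s) * norm x"
      by (simp add: algebra_simps)
    then show ?thesis by simp
  qed
  ultimately obtain f :: "'a \<Rightarrow>\<^sub>L real"
    where f: "norm f \<le> 1" "\<And>z t. (z, t) \<in> ?A \<Longrightarrow> f z \<le> t"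
    using hahn_banach_cone[of 1 ?A] zero_le_one by blast
  have "f (s *\<^sub>R x) \<le> s * norm x" for s
    by (rule f(2)) auto
  from this[of 1] this[of "-1"]
  have "f x = norm x" by (simp add: blinfun.minus_right)
  with f(1) show ?thesis by (rule that)
qed

section \<open>Helly's theorem\<close>

text \<open>Helly's theorem: finitely many moment equations \<open>phi i v = c i\<close> are approximately solvable in the
  ball of radius \<open>M\<close> once the obvious necessary inequality holds. Instead of separating points in a
  Euclidean space of varying dimension, minimise the squared error \<open>q\<close> over the ball. At a
  near-minimiser \<open>v\<close>, the functional \<open>A\<close> whose coefficients are the errors is nearly maximal over the
  ball, so \<open>M * norm A\<close> is about \<open>A v\<close>, which is the sum of the \<open>a i * c i\<close> minus the squared error. The
  hypothesis applied to these coefficients then forces the error to be small.\<close>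
lemma helly_approximate:
  fixes phi :: "'i \<Rightarrow> 'v::real_normed_vector \<Rightarrow>\<^sub>L real"
  assumes I: "finite I" and M: "0 \<le> M"
    and bound: "\<And>a. \<bar>\<Sum>i\<in>I. a i * c i\<bar> \<le> M * norm (\<Sum>i\<in>I. a i *\<^sub>R phi i)"
    and eps: "0 < \<epsilon>"
  obtains v where "norm v \<le> M" "\<And>i. i \<in> I \<Longrightarrow> \<bar>phi i v - c i\<bar> \<le> \<epsilon>"
proof -
  define B where "B = cball (0::'v) M"
  define q where "q v = (\<Sum>i\<in>I. (phi i v - c i)\<^sup>2)" for v
  define s where "s = (INF v\<in>B. q v)"
  have "0 \<le> q v" for v by (simp add: q_def sum_nonneg)
  then have bdd: "bdd_below (q ` B)" by (auto intro!: bdd_belowI)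
  have B0: "0 \<in> B" using M by (simp add: B_def)
  have s_le: "s \<le> q v" if "v \<in> B" for v
    unfolding s_def by (rule cINF_lower[OF bdd that])
  define K where "K = (\<Sum>i\<in>I. (2 * M * norm (phi i))\<^sup>2)"
  have K: "0 \<le> K" by (simp add: K_def sum_nonneg)
  have "s \<le> 0"
  proof (rule ccontr)
    assume "\<not> s \<le> 0"
    then have s: "0 < s" by simp
    \<comment> \<open>The step size \<open>t\<close> makes the second-order term \<open>t\<^sup>2 * K\<close> of the expansion of \<open>q\<close> small
      against the first-order gain \<open>t * s\<close>.\<close>
    define t where "t = min 1 (s / (2 * (K + 1)))"
    have t: "0 < t" "t \<le> 1" using s K by (auto simp: t_def)
    have "t \<le> s / 2 / (K + 1)" by (simp add: t_def)
    then have "t * (K + 1) \<le> s / 2"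
      using K by (subst (asm) pos_le_divide_eq) auto
    then have tK: "t * K \<le> s / 2" using t by (simp add: algebra_simps)
    have "\<exists>v\<in>B. q v < s + t * s / 2"
    proof -
      have "(INF v\<in>B. q v) < s + t * s / 2" using s t by (simp add: s_def[symmetric])
      then show ?thesis using B0 bdd by (subst (asm) cINF_less_iff) auto
    qed
    then obtain v where v: "v \<in> B" "q v < s + t * s / 2" by blast
    define a where "a i = c i - phi i v" for i
    define A where "A = (\<Sum>i\<in>I. a i *\<^sub>R phi i)"
    have A_apply: "A w = (\<Sum>i\<in>I. a i * phi i w)" for w
      by (simp add: A_def blinfun.sum_left blinfun.scaleR_left)
    \<comment> \<open>Moving from \<open>v\<close> towards any \<open>w\<close> in the ball cannot push \<open>q\<close> below its infimum \<open>s\<close>.\<close>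
    have step: "A w \<le> A v + 3 * s / 4" if w: "w \<in> B" for w
    proof -
      have conv: "v + t *\<^sub>R (w - v) \<in> B"
      proof -
        have "convex B" by (simp add: B_def)
        from convexD_alt[OF this v(1) w, of t] t show ?thesis
          by (simp add: algebra_simps)
      qed
      have "q (v + t *\<^sub>R (w - v)) =
          (\<Sum>i\<in>I. (phi i v - c i)\<^sup>2 - 2 * t * (a i * phi i w - a i * phi i v)
             + t\<^sup>2 * (phi i (w - v))\<^sup>2)"
        unfolding q_def a_def
        by (intro sum.cong refl)
          (simp add: blinfun.add_right blinfun.diff_right blinfun.scaleR_right
            power2_eq_square algebra_simps)
      also have "\<dots> = q v - 2 * t * (A w - A v) + t\<^sup>2 * (\<Sum>i\<in>I. (phi i (w - v))\<^sup>2)"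
        by (simp add: sum.distrib sum_subtractf sum_distrib_left q_def A_apply algebra_simps)
      also have "\<dots> \<le> q v - 2 * t * (A w - A v) + t\<^sup>2 * K"
      proof -
        have "(phi i (w - v))\<^sup>2 \<le> (2 * M * norm (phi i))\<^sup>2" for i
        proof -
          have "\<bar>phi i (w - v)\<bar> \<le> norm (phi i) * norm (w - v)"
            using norm_blinfun[of "phi i" "w - v"] by simp
          also have "\<dots> \<le> norm (phi i) * (2 * M)"
            using norm_triangle_ineq4[of w v] w v by (intro mult_left_mono) (auto simp: B_def)
          finally show ?thesis
            by (metis abs_le_square_iff abs_ge_self mult.commute order_trans)
        qed
        then show ?thesis
          unfolding K_def by (intro add_left_mono mult_left_mono sum_mono) auto
      qed
      finally have "2 * t * (A w - A v) \<le> t * s / 2 + t\<^sup>2 * K"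
        using s_le[OF conv] v(2) by linarith
      also have "t\<^sup>2 * K \<le> t * (s / 2)"
        using mult_left_mono[OF tK, of t] t by (simp add: power2_eq_square mult.assoc)
      finally have "t * (2 * (A w - A v)) \<le> t * s"
        by (simp add: algebra_simps)
      then show ?thesis using t s by simp
    qed
    have "M * norm A \<le> A v + 3 * s / 4"
    proof (cases "M = 0")
      case True
      then show ?thesis using step[OF B0] by (simp add: blinfun.zero_right)
    next
      case False
      then have M: "0 < M" using M by simp
      have "norm (A w) \<le> ((A v + 3 * s / 4) / M) * norm w" for w
      proof (cases "w = 0")
        case w: False
        have "norm ((M / norm w) *\<^sub>R w) = M" "norm (-((M / norm w) *\<^sub>R w)) = M"
          using w M by auto
        then have "(M / norm w) *\<^sub>R w \<in> B" "-((M / norm w) *\<^sub>R w) \<in> B"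
          by (simp_all add: B_def)
        from this[THEN step] have "\<bar>M / norm w * A w\<bar> \<le> A v + 3 * s / 4"
          by (simp add: blinfun.scaleR_right blinfun.minus_right)
        then show ?thesis
          using M w by (simp add: abs_mult field_simps)
      qed (simp add: blinfun.zero_right)
      moreover have "0 \<le> A v + 3 * s / 4"
        using step[OF B0] by (simp add: blinfun.zero_right)
      ultimately have "norm A \<le> (A v + 3 * s / 4) / M"
        using M by (intro norm_blinfun_bound) auto
      then show ?thesis using M by (simp add: field_simps)
    qed
    moreover have "A v = (\<Sum>i\<in>I. a i * c i) - q v"
      unfolding A_apply q_def sum_subtractf[symmetric]
      by (intro sum.cong refl) (simp add: a_def power2_eq_square algebra_simps)
    moreover have "(\<Sum>i\<in>I. a i * c i) \<le> M * norm A"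
      using bound[of a] by (simp add: A_def)
    ultimately show False using s_le[OF v(1)] s by linarith
  qed
  then have "(INF v\<in>B. q v) < \<epsilon>\<^sup>2"
    using eps unfolding s_def[symmetric] by (smt (verit) zero_less_power)
  then obtain v where v: "v \<in> B" "q v < \<epsilon>\<^sup>2"
    using B0 bdd by (subst (asm) cINF_less_iff) auto
  show ?thesis
  proof (rule that)
    show "norm v \<le> M" using v by (simp add: B_def)
    fix i assume "i \<in> I"
    then have "(phi i v - c i)\<^sup>2 \<le> q v"
      unfolding q_def using I by (intro member_le_sum) auto
    then have "(phi i v - c i)\<^sup>2 \<le> \<epsilon>\<^sup>2" using v by simp
    then show "\<bar>phi i v - c i\<bar> \<le> \<epsilon>"
      using eps by (simp add: abs_le_square_iff[symmetric])
  qed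
qed

section \<open>James systems\<close>

text \<open>With \<open>a < b\<close>, the vector \<open>x k\<close> separates the functionals up to index \<open>k\<close> from the later ones, hence also
  their convex hulls. Only this separation matters, so one-sided bounds replace the exact
  values 0 and \<open>\<theta>\<close> of the classical formulation; they are stable under small perturbations.\<close>
definition james_system ::
  "real \<Rightarrow> real \<Rightarrow> real \<Rightarrow> nat \<Rightarrow> (nat \<Rightarrow> 'a::real_normed_vector \<Rightarrow>\<^sub>L real) \<Rightarrow> (nat \<Rightarrow> 'a) \<Rightarrow> bool"
  where "james_system M a b N g x \<longleftrightarrow>
    (\<forall>i<N. norm (g i) \<le> M \<and> norm (x i) \<le> M) \<and>
    (\<forall>i<N. \<forall>k<N. (i \<le> k \<longrightarrow> b \<le> g i (x k)) \<and> (k < i \<longrightarrow> g i (x k) \<le> a))"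

lemma canonical_embedding_apply [simp]: "canonical_embedding x f = f x"
  by (simp add: canonical_embedding.rep_eq)

lemma norm_canonical_embedding: "norm (canonical_embedding x) = norm x"
proof (rule antisym)
  show "norm (canonical_embedding x) \<le> norm x"
    by (rule norm_blinfun_bound) (simp_all add: norm_blinfun mult.commute[of "norm x"]
        del: real_norm_def)
  obtain f :: "'a \<Rightarrow>\<^sub>L real" where f: "norm f \<le> 1" "f x = norm x"
    by (rule norming_functional)
  have "norm x \<le> norm (canonical_embedding x) * norm f"
    using norm_blinfun[of "canonical_embedding x" f] f(2) by simp
  also have "\<dots> \<le> norm (canonical_embedding x) * 1"
    using f(1) by (intro mult_left_mono) auto
  finally show "norm x \<le> norm (canonical_embedding x)" by simp
qed

lemma linear_canonical_embedding: "linear canonical_embedding"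
  by (rule linearI; rule blinfun_eqI)
    (simp_all add: blinfun.add_left blinfun.add_right blinfun.scaleR_left blinfun.scaleR_right)

text \<open>Completeness makes the range closed, so an element of the bidual outside the range
  has positive distance from it.\<close>
lemma closed_range_canonical_embedding:
  "closed (range (canonical_embedding :: 'a::banach \<Rightarrow> _))"
proof (rule complete_imp_closed, rule complete_isometric_image[of 1])
  show "bounded_linear (canonical_embedding :: 'a \<Rightarrow> _)"
    by (rule bounded_linear_intro[where K = 1])
      (simp_all add: linear_add[OF linear_canonical_embedding]
        linear_scale[OF linear_canonical_embedding] norm_canonical_embedding)
qed (simp_all add: norm_canonical_embedding complete_UNIV)

text \<open>Let \<open>F\<close> be a bidual element at distance \<open>d > 0\<close> from the space. Given the system built so far,
  Helly's theorem in the dual gives a functional with \<open>F\<close>-value close to \<open>d\<close> that almost vanishes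
  on the vectors already chosen: its hypothesis is exactly that \<open>F\<close> has distance \<open>d\<close> from the
  span of those vectors. Helly's theorem in the space itself then gives a vector on which all functionals chosen
  so far take almost the values that \<open>F\<close> assigns to them, that is, values close to \<open>d\<close>.\<close>
proposition nonreflexive_james_systems:
  assumes "\<not> reflexive TYPE('c::banach)"
  obtains M d :: real where "0 < M" "0 < d"
    "\<And>N. \<exists>(g :: nat \<Rightarrow> 'c \<Rightarrow>\<^sub>L real) x. james_system M (d / 4) (3 * d / 4) N g x"
proof -
  let ?J = "canonical_embedding :: 'c \<Rightarrow> ('c \<Rightarrow>\<^sub>L real) \<Rightarrow>\<^sub>L real"
  obtain F where "F \<notin> range ?J"
    using assms unfolding reflexive_def by auto
  define d where "d = infdist F (range ?J)"
  have d: "0 < d"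
    unfolding d_def by (rule infdist_pos_not_in_closed)
      (use \<open>F \<notin> range ?J\<close> closed_range_canonical_embedding in auto)
  have far: "\<bar>r\<bar> * d \<le> norm (r *\<^sub>R F + ?J u)" for r u
  proof (cases "r = 0")
    case False
    define w where "w = - (inverse r *\<^sub>R u)"
    have "?J u = ?J ((- r) *\<^sub>R w)"
      using False by (simp add: w_def)
    then have "r *\<^sub>R F + ?J u = r *\<^sub>R (F - ?J w)"
      unfolding linear_scale[OF linear_canonical_embedding] by (simp add: algebra_simps)
    moreover have "d \<le> norm (F - ?J w)"
      unfolding d_def dist_norm[symmetric] by (rule infdist_le) simp
    ultimately show ?thesis by (simp add: mult_left_mono)
  qed simp
  define good where "good N f x \<longleftrightarrow>
      (\<forall>i<N. norm (f i) \<le> 1 \<and> \<bar>F (f i) - d\<bar> \<le> d / 8 \<and> norm (x i) \<le> norm F) \<and>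
      (\<forall>i<N. \<forall>k<N. (i \<le> k \<longrightarrow> \<bar>f i (x k) - F (f i)\<bar> \<le> d / 8) \<and>
                    (k < i \<longrightarrow> \<bar>f i (x k)\<bar> \<le> d / 8))"
    for N :: nat and f :: "nat \<Rightarrow> 'c \<Rightarrow>\<^sub>L real" and x
  have "\<exists>f x. good N f x" for N
  proof (induction N)
    case 0
    then show ?case by (simp add: good_def)
  next
    case (Suc N)
    then obtain f x where fx: "good N f x" by blast
    define \<phi> where "\<phi> i = (if i < N then ?J (x i) else F)" for i
    have "\<bar>\<Sum>i<Suc N. a i * (if i < N then 0 else d)\<bar> \<le> 1 * norm (\<Sum>i<Suc N. a i *\<^sub>R \<phi> i)" for a
    proof -
      have "(\<Sum>i<Suc N. a i *\<^sub>R \<phi> i) = a N *\<^sub>R F + ?J (\<Sum>i<N. a i *\<^sub>R x i)"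
        by (simp add: \<phi>_def linear_sum[OF linear_canonical_embedding]
            linear_scale[OF linear_canonical_embedding])
      moreover have "(\<Sum>i<Suc N. a i * (if i < N then 0 else d)) = a N * d"
        by simp
      ultimately show ?thesis
        using far[of "a N"] d by (simp add: abs_mult)
    qed
    then obtain h where h: "norm h \<le> 1"
      and h\<phi>: "\<And>i. i < Suc N \<Longrightarrow> \<bar>\<phi> i h - (if i < N then 0 else d)\<bar> \<le> d / 8"
      using helly_approximate[of "{..<Suc N}" 1 "\<lambda>i. if i < N then 0 else d" \<phi> "d / 8"] d
      by auto
    from h\<phi>[of N] have hF: "\<bar>F h - d\<bar> \<le> d / 8"
      by (simp add: \<phi>_def)
    have hx: "\<bar>h (x i)\<bar> \<le> d / 8" if "i < N" for i
      using h\<phi>[of i] that by (simp add: \<phi>_def)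
    define f' where "f' = f(N := h)"
    have "\<bar>\<Sum>i<Suc N. a i * F (f' i)\<bar> \<le> norm F * norm (\<Sum>i<Suc N. a i *\<^sub>R f' i)" for a
      using norm_blinfun[of F "\<Sum>i<Suc N. a i *\<^sub>R f' i"]
      by (simp only: blinfun.sum_right blinfun.scaleR_right real_norm_def real_scaleR_def)
    then obtain v where v: "norm v \<le> norm F"
      and fv: "\<And>i. i < Suc N \<Longrightarrow> \<bar>f' i v - F (f' i)\<bar> \<le> d / 8"
      using helly_approximate[of "{..<Suc N}" "norm F" "\<lambda>i. F (f' i)" f' "d / 8"] d
      by auto
    have "good (Suc N) f' (x(N := v))"
      using fx h hF hx v fv unfolding good_def f'_def by (auto simp: less_Suc_eq)
    then show ?case by blast
  qed
  then have ex: "\<exists>f x. good N f x" for N .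
  have "\<exists>(g :: nat \<Rightarrow> 'c \<Rightarrow>\<^sub>L real) x. james_system (norm F + 1) (d / 4) (3 * d / 4) N g x" for N
  proof -
    obtain f x where fx: "good N f x" using ex by blast
    have "3 * d / 4 \<le> f i (x k)" if "i < N" "k < N" "i \<le> k" for i k
    proof -
      have "\<bar>F (f i) - d\<bar> \<le> d / 8" "\<bar>f i (x k) - F (f i)\<bar> \<le> d / 8"
        using fx that by (auto simp: good_def)
      then show ?thesis by linarith
    qed
    moreover have "f i (x k) \<le> d / 4" if "i < N" "k < N" "k < i" for i k
    proof -
      have "\<bar>f i (x k)\<bar> \<le> d / 8"
        using fx that by (auto simp: good_def)
      then show ?thesis using d by linarith
    qed
    moreover have "norm (f i) \<le> norm F + 1" "norm (x i) \<le> norm F + 1" if "i < N" for i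
    proof -
      have "norm (f i) \<le> 1" "norm (x i) \<le> norm F" using fx that by (auto simp: good_def)
      then show "norm (f i) \<le> norm F + 1" "norm (x i) \<le> norm F + 1"
        using norm_ge_zero[of F] by linarith+
    qed
    ultimately have "james_system (norm F + 1) (d / 4) (3 * d / 4) N f x"
      unfolding james_system_def by blast
    then show ?thesis by blast
  qed
  then show ?thesis
    using d by (intro that[of "norm F + 1" d]) (auto simp: add_nonneg_pos)
qed

text \<open>Take an operator \<open>T\<close> with distortion 2 on the span \<open>S\<close> of the vectors \<open>x k\<close>. The values \<open>g i u\<close> prescribed
  at \<open>T u\<close> extend to functionals of norm at most \<open>2 * M\<close> on the completion, and each \<open>T (x k)\<close> is approximated
  by the image of some \<open>y k\<close>. The loss \<open>e\<close> pays for that approximation.\<close>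
proposition james_system_transfer:
  fixes j :: "'y::real_normed_vector \<Rightarrow> 'b::banach"
    and g :: "nat \<Rightarrow> 'c::real_normed_vector \<Rightarrow>\<^sub>L real"
  assumes j: "is_completion j" and rep: "finitely_representable TYPE('c) TYPE('b)"
    and gx: "james_system M a b N g x" and M: "0 \<le> M" and e: "0 < e"
  obtains h :: "nat \<Rightarrow> 'y \<Rightarrow>\<^sub>L real" and y
  where "james_system (2 * M + e) (a + e) (b - e) N h y"
proof -
  have normg: "norm (g i) \<le> M" and normx: "norm (x i) \<le> M" if "i < N" for i
    using gx that by (auto simp: james_system_def)
  define S where "S = span (x ` {..<N})"
  have xS: "x i \<in> S" if "i < N" for i
    unfolding S_def using that by (auto intro: span_base)
  have S: "subspace S" by (simp add: S_def)
  have "finite_dim S" unfolding finite_dim_def S_def by blast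
  then obtain T :: "'c \<Rightarrow> 'b" where T: "\<And>u v. u \<in> S \<Longrightarrow> v \<in> S \<Longrightarrow> T (u + v) = T u + T v"
    "\<And>r u. u \<in> S \<Longrightarrow> T (r *\<^sub>R u) = r *\<^sub>R T u"
    "\<And>u. u \<in> S \<Longrightarrow> norm u / (1 + 1) \<le> norm (T u) \<and> norm (T u) \<le> (1 + 1) * norm u"
    using rep zero_less_one unfolding finitely_representable_def by (metis (no_types))
  have "\<exists>L :: 'b \<Rightarrow>\<^sub>L real. norm L \<le> 2 * M \<and> (\<forall>u\<in>S. blinfun_apply L (T u) = g i u)" if i: "i < N" for i
  proof -
    let ?A = "(\<lambda>u. (T u, g i u)) ` S"
    have inA: "(T u, g i u) \<in> ?A" if "u \<in> S" for u
      using that by (rule imageI)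
    have cone: "convex_cone ?A"
      unfolding convex_cone_iff
    proof (intro conjI ballI allI impI)
      show "0 \<in> ?A"
        using inA[OF subspace_0[OF S]] T(2)[OF subspace_0[OF S], of 0]
        by (simp add: zero_prod_def)
    next
      fix p q assume "p \<in> ?A" "q \<in> ?A"
      then obtain u v where uv: "u \<in> S" "v \<in> S" "p = (T u, g i u)" "q = (T v, g i v)" by blast
      then show "p + q \<in> ?A"
        using inA[OF subspace_add[OF S uv(1,2)]] by (simp add: T(1) blinfun.add_right)
    next
      fix p and r :: real assume "p \<in> ?A"
      then obtain u where u: "u \<in> S" "p = (T u, g i u)" by blast
      then show "r *\<^sub>R p \<in> ?A"
        using inA[OF subspace_scale[OF S u(1), of r]] by (simp add: T(2) blinfun.scaleR_right)
    qed
    have pos: "0 \<le> 2 * M * norm z + t" if zt: "(z, t) \<in> ?A" for z t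
    proof -
      obtain u where u: "u \<in> S" "z = T u" "t = g i u" using zt by blast
      have "\<bar>g i u\<bar> \<le> M * norm u"
        using norm_blinfun[of "g i" u] mult_right_mono[OF normg[OF i], of "norm u"] by simp
      also have "\<dots> \<le> M * (2 * norm (T u))"
        using T(3)[OF u(1)] M by (intro mult_left_mono) auto
      finally show ?thesis using u by simp
    qed
    obtain L :: "'b \<Rightarrow>\<^sub>L real" where L: "norm L \<le> 2 * M" "\<And>z t. (z, t) \<in> ?A \<Longrightarrow> L z \<le> t"
      using hahn_banach_cone[OF _ cone pos] M by (metis mult_nonneg_nonneg zero_le_numeral)
    have "L (T u) = g i u" if u: "u \<in> S" for u
    proof -
      have "L (T u) \<le> g i u" "L (T ((-1) *\<^sub>R u)) \<le> g i ((-1) *\<^sub>R u)"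
        using L(2) inA u subspace_scale[OF S] by blast+
      then show ?thesis
        using T(2)[OF u, of "-1"] by (simp add: blinfun.minus_right)
    qed
    then show ?thesis using L(1) by blast
  qed
  then obtain L :: "nat \<Rightarrow> 'b \<Rightarrow>\<^sub>L real"
    where normL: "\<And>i. i < N \<Longrightarrow> norm (L i) \<le> 2 * M"
      and LT: "\<And>i u. i < N \<Longrightarrow> u \<in> S \<Longrightarrow> L i (T u) = g i u" by metis
  have j_linear: "linear j" and j_norm: "\<And>y. norm (j y) = norm y" and "closure (range j) = UNIV"
    using j by (auto simp: is_completion_def)
  then have j_bl: "bounded_linear j"
    by (intro bounded_linear_intro[where K = 1]) (simp_all add: linear_add linear_scale)
  \<comment> \<open>The tolerance for \<open>y k\<close> must leave an error of at most \<open>e\<close> in the values, where the functionals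
    have norm at most \<open>2 * M\<close>, and of at most \<open>e\<close> in the norms.\<close>
  define \<tau> where "\<tau> = e / (2 * M + 1)"
  have \<tau>: "0 < \<tau>" "(2 * M + 1) * \<tau> = e" using e M by (auto simp: \<tau>_def)
  have \<tau>e: "\<tau> \<le> e" "2 * M * \<tau> \<le> e"
  proof -
    have "0 \<le> 2 * M * \<tau>" using \<tau>(1) M by simp
    then show "\<tau> \<le> e" "2 * M * \<tau> \<le> e"
      using \<tau> by (simp_all add: distrib_right)
  qed
  have "\<exists>y. dist (j y) (T (x k)) < \<tau>" for k
    using \<open>closure (range j) = UNIV\<close> \<tau>(1) closure_approachable[of "T (x k)" "range j"] by auto
  then obtain y where y: "\<And>k. dist (j (y k)) (T (x k)) < \<tau>"
    by metis
  define h where "h i = L i o\<^sub>L Blinfun j" for i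
  have h_apply: "h i v = L i (j v)" for i v
    by (simp add: h_def bounded_linear_Blinfun_apply[OF j_bl])
  have close: "\<bar>h i (y k) - g i (x k)\<bar> \<le> e" if "i < N" "k < N" for i k
  proof -
    have "h i (y k) - g i (x k) = L i (j (y k) - T (x k))"
      using LT[OF that(1) xS[OF that(2)]] by (simp add: h_apply blinfun.diff_right)
    also have "\<bar>\<dots>\<bar> \<le> norm (L i) * norm (j (y k) - T (x k))"
      using norm_blinfun[of "L i" "j (y k) - T (x k)"] by simp
    also have "\<dots> \<le> (2 * M) * \<tau>"
      using normL[OF that(1)] y[of k] M by (intro mult_mono) (auto simp: dist_norm)
    finally show ?thesis using \<tau>e by simp
  qed
  have "norm (h i) \<le> 2 * M + e" if "i < N" for i
  proof (rule norm_blinfun_bound)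
    fix v
    have "norm (h i v) \<le> norm (L i) * norm v"
      using norm_blinfun[of "L i" "j v"] by (simp add: h_apply j_norm)
    also have "\<dots> \<le> (2 * M + e) * norm v"
      using normL[OF that] e by (intro mult_right_mono) auto
    finally show "norm (h i v) \<le> (2 * M + e) * norm v" .
  qed (use M e in auto)
  moreover have "norm (y k) \<le> 2 * M + e" if "k < N" for k
    using norm_triangle_ineq2[of "j (y k)" "T (x k)"] y[of k] \<tau>e T(3)[OF xS[OF that]] normx[OF that]
    by (simp add: j_norm dist_norm)
  moreover have "b - e \<le> h i (y k)" if "i < N" "k < N" "i \<le> k" for i k
  proof -
    have "b \<le> g i (x k)" using gx that by (simp add: james_system_def)
    then show ?thesis using close[OF that(1,2)] by linarith
  qed
  moreover have "h i (y k) \<le> a + e" if "i < N" "k < N" "k < i" for i k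
  proof -
    have "g i (x k) \<le> a" using gx that by (simp add: james_system_def)
    then show ?thesis using close[OF that(1,2)] by linarith
  qed
  ultimately have "james_system (2 * M + e) (a + e) (b - e) N h y"
    unfolding james_system_def by blast
  then show ?thesis by (rule that)
qed

section \<open>Local uniform convexity of the dual norm\<close>

lemma norm_derivative_bounds:
  fixes D :: "'a::real_normed_vector \<Rightarrow>\<^sub>L real"
  assumes D: "(norm has_derivative D) (at x)"
  shows "norm D \<le> 1" "D x = norm x"
proof -
  have deriv: "((\<lambda>t. norm (x + t *\<^sub>R v)) has_field_derivative D v) (at 0)" for v
  proof -
    have "((\<lambda>t. x + t *\<^sub>R v) has_derivative (\<lambda>t. t *\<^sub>R v)) (at 0)"
      by (auto intro!: derivative_eq_intros)
    moreover have "(norm has_derivative D) (at (x + 0 *\<^sub>R v))"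
      using D by simp
    ultimately have "((\<lambda>t. norm (x + t *\<^sub>R v)) has_derivative (\<lambda>t. D (t *\<^sub>R v))) (at 0)"
      by (rule has_derivative_compose)
    then show ?thesis
      by (simp add: has_field_derivative_def blinfun.scaleR_right mult.commute[of _ "D v"])
  qed
  have quot: "((\<lambda>t. (norm (x + t *\<^sub>R v) - norm x) / t) \<longlongrightarrow> D v) (at 0)" for v
    using deriv[of v] by (simp add: DERIV_def)
  have "norm (D v) \<le> 1 * norm v" for v
  proof -
    have "((\<lambda>t. norm ((norm (x + t *\<^sub>R v) - norm x) / t)) \<longlongrightarrow> norm (D v)) (at 0)"
      by (intro tendsto_norm quot)
    moreover have "\<forall>\<^sub>F t in at 0. norm ((norm (x + t *\<^sub>R v) - norm x) / t) \<le> norm v"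
    proof (rule eventually_at_filter[THEN iffD2], intro always_eventually allI impI)
      fix t :: real assume t: "t \<noteq> 0"
      have "\<bar>norm (x + t *\<^sub>R v) - norm x\<bar> \<le> norm (t *\<^sub>R v)"
        using norm_triangle_ineq3[of "x + t *\<^sub>R v" x] by simp
      then show "norm ((norm (x + t *\<^sub>R v) - norm x) / t) \<le> norm v"
        using t by (simp add: field_simps)
    qed
    ultimately have "norm (D v) \<le> norm v"
      by (rule tendsto_upperbound) simp
    then show ?thesis by simp
  qed
  then show "norm D \<le> 1"
    by (intro norm_blinfun_bound) auto
  have "((\<lambda>t. (norm (x + t *\<^sub>R x) - norm x) / t) \<longlongrightarrow> norm x) (at 0)"
  proof (rule tendsto_eventually)
    have "\<forall>\<^sub>F t in at (0::real). dist t 0 < 1 \<and> t \<noteq> 0"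
      unfolding eventually_at by (intro exI[of _ 1]) auto
    then show "\<forall>\<^sub>F t in at 0. (norm (x + t *\<^sub>R x) - norm x) / t = norm x"
    proof eventually_elim
      fix t :: real assume t: "dist t 0 < 1 \<and> t \<noteq> 0"
      have "norm (x + t *\<^sub>R x) = norm ((1 + t) *\<^sub>R x)"
        by (simp add: algebra_simps)
      also have "\<dots> = (1 + t) * norm x"
        using t by (auto simp: dist_real_def abs_if split: if_splits)
      finally show "(norm (x + t *\<^sub>R x) - norm x) / t = norm x"
        using t by (simp add: field_simps)
    qed
  qed
  from LIM_unique[OF quot this] show "D x = norm x" .
qed

text \<open>LUR is used only through this: if \<open>f (y n)\<close> tends to 1, then so does \<open>f (y n + x) / 2\<close>, hence
  \<open>norm (y n + x)\<close> tends to 2. In other words \<open>f\<close> strongly exposes the unit ball at \<open>x\<close>.\<close>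
lemma LUR_slices_shrink:
  fixes x :: "'a::real_normed_vector" and f :: "'a \<Rightarrow>\<^sub>L real"
  assumes lur: "LUR_norm TYPE('a)" and x: "norm x = 1"
    and f: "norm f \<le> 1" "f x = 1" and r: "0 < r"
  obtains \<eta> where "0 < \<eta>" "\<And>y. norm y = 1 \<Longrightarrow> 1 - \<eta> < f y \<Longrightarrow> dist y x < r"
proof (rule ccontr)
  assume "\<not> thesis"
  then have "\<exists>y. norm y = 1 \<and> 1 - 1 / real (Suc n) < f y \<and> \<not> dist y x < r" for n
    using that[of "1 / real (Suc n)"] by fastforce
  then obtain y where y: "\<And>n. norm (y n) = 1" "\<And>n. 1 - 1 / real (Suc n) < f (y n)"
    and far: "\<And>n. \<not> dist (y n) x < r" by metis
  have "(\<lambda>n. norm (y n + x)) \<longlonglongrightarrow> 2"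
  proof (rule tendsto_sandwich)
    show "\<forall>\<^sub>F n in sequentially. 2 - inverse (real (Suc n)) \<le> norm (y n + x)"
    proof (intro always_eventually allI)
      fix n
      have "f (y n + x) \<le> norm (y n + x)"
        using norm_blinfun[of f "y n + x"] f(1) mult_right_mono[OF f(1), of "norm (y n + x)"]
        by simp
      then show "2 - inverse (real (Suc n)) \<le> norm (y n + x)"
        using y(2)[of n] f(2) by (simp add: blinfun.add_right inverse_eq_divide)
    qed
    show "\<forall>\<^sub>F n in sequentially. norm (y n + x) \<le> 2"
      using norm_triangle_ineq[of "y _" x] y(1) x by (intro always_eventually allI) simp
    show "(\<lambda>n. 2 - inverse (real (Suc n))) \<longlonglongrightarrow> 2"
      using tendsto_diff[OF tendsto_const[of 2] LIMSEQ_inverse_real_of_nat] by simp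
  qed simp
  then have "y \<longlonglongrightarrow> x"
    using lur x y(1) by (simp add: LUR_norm_def)
  then have "\<forall>\<^sub>F n in sequentially. dist (y n) x < r"
    using r by (rule tendstoD)
  then show False
    using far by (auto simp: eventually_sequentially)
qed

text \<open>The second difference of the norm at \<open>y\<close> in the direction \<open>z\<close> is at most \<open>t\<close> times the difference
  of the derivatives at the two normalised points \<open>y \<plusminus> t z\<close>. These points lie within \<open>2 * t\<close> of \<open>y\<close>, so
  uniform continuity yields one \<open>t\<close> for all \<open>y\<close> near \<open>x\<close>.\<close>
lemma derivative_controls_smoothness:
  fixes D :: "'a::real_normed_vector \<Rightarrow> 'a \<Rightarrow>\<^sub>L real"
  assumes D: "\<And>w. norm w = 1 \<Longrightarrow> (norm has_derivative D w) (at w)"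
    and U: "uniformly_continuous_on (ball x r \<inter> sphere 0 1) D" and r: "0 < r" and e: "0 < e"
  obtains t where "0 < t"
    "\<And>y z. norm y = 1 \<Longrightarrow> dist y x < r / 2 \<Longrightarrow> norm z = 1 \<Longrightarrow>
       norm (y + t *\<^sub>R z) + norm (y - t *\<^sub>R z) \<le> 2 + e * t"
proof -
  obtain d where d: "0 < d"
    and cont: "\<And>u v. u \<in> ball x r \<inter> sphere 0 1 \<Longrightarrow> v \<in> ball x r \<inter> sphere 0 1 \<Longrightarrow>
      dist u v < d \<Longrightarrow> dist (D u) (D v) < e"
    using U e unfolding uniformly_continuous_on_def by metis
  define t where "t = min (1/2) (min (r / 5) (d / 5))"
  have t: "0 < t" "t \<le> 1/2" "2 * t < r / 2" "4 * t < d"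
    using r d by (auto simp: t_def)
  have normD: "norm (D w) \<le> 1" "D w w = 1" if "norm w = 1" for w
    using norm_derivative_bounds[OF D[OF that]] that by auto
  \<comment> \<open>The supporting functional \<open>D u\<close> at the normalisation \<open>u\<close> of \<open>y + s z\<close> attains the norm of
    \<open>y + s z\<close>, and is at most 1 at \<open>y\<close>.\<close>
  have support: "\<exists>u. norm u = 1 \<and> dist u y \<le> 2 * t \<and> norm (y + s *\<^sub>R z) \<le> 1 + s * D u z"
    if y: "norm y = 1" and z: "norm z = 1" and s: "\<bar>s\<bar> = t" for y z s
  proof -
    define w where "w = y + s *\<^sub>R z"
    have nw: "\<bar>norm w - 1\<bar> \<le> t"
      using norm_triangle_ineq3[of w y] y z s by (simp add: w_def)
    then have w: "0 < norm w" using t by linarith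
    define u where "u = w /\<^sub>R norm w"
    have u: "norm u = 1" using w by (simp add: u_def)
    have wu: "w = norm w *\<^sub>R u" using w by (simp add: u_def)
    have "dist u w = \<bar>norm w - 1\<bar>"
    proof -
      have "u - w = (1 - norm w) *\<^sub>R u" using wu by (simp add: algebra_simps)
      then show ?thesis using u by (simp add: dist_norm)
    qed
    moreover have "dist w y = t" using z s by (simp add: w_def dist_norm)
    ultimately have "dist u y \<le> 2 * t"
      using dist_triangle[of u y w] nw by linarith
    moreover have "norm w = D u w"
      using normD(2)[OF u] by (subst (2) wu) (simp add: blinfun.scaleR_right)
    moreover have "D u y \<le> 1"
      using norm_blinfun[of "D u" y] normD(1)[OF u] y by simp
    ultimately show ?thesis
      using u by (auto simp: w_def blinfun.add_right blinfun.scaleR_right)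
  qed
  show ?thesis
  proof (rule that[OF t(1)])
    fix y z :: 'a
    assume y: "norm y = 1" "dist y x < r / 2" and z: "norm z = 1"
    obtain u where u: "norm u = 1" "dist u y \<le> 2 * t" "norm (y + t *\<^sub>R z) \<le> 1 + t * D u z"
      using support[OF y(1) z, of t] t by auto
    obtain v where v: "norm v = 1" "dist v y \<le> 2 * t" "norm (y - t *\<^sub>R z) \<le> 1 - t * D v z"
      using support[OF y(1) z, of "- t"] t by auto
    have "dist u x < r" "dist v x < r"
      using dist_triangle[of u x y] dist_triangle[of v x y] u(2) v(2) y(2) t(3) by linarith+
    then have "dist (D u) (D v) < e"
      using dist_triangle2[of u v y] u v t(4)
      by (intro cont) (auto simp: dist_commute)
    then have "(D u - D v) z \<le> e"
      using norm_blinfun[of "D u - D v" z] z by (simp add: dist_norm)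
    then have "t * (D u z - D v z) \<le> t * e"
      using t by (intro mult_left_mono) (auto simp: blinfun.diff_left)
    then show "norm (y + t *\<^sub>R z) + norm (y - t *\<^sub>R z) \<le> 2 + e * t"
      using u(3) v(3) by (simp add: algebra_simps)
  qed
qed

lemma almost_norming_vector:
  fixes g :: "'a::real_normed_vector \<Rightarrow>\<^sub>L real"
  assumes "0 \<le> c" "c < norm g"
  shows "\<exists>y. norm y = 1 \<and> c < g y"
proof (rule ccontr)
  assume "\<nexists>y. norm y = 1 \<and> c < g y"
  then have unit: "g u \<le> c" if "norm u = 1" for u
    using that by (meson not_le)
  have "norm (g x) \<le> c * norm x" for x
  proof (cases "x = 0")
    case False
    define u where "u = inverse (norm x) *\<^sub>R x"
    have u: "norm u = 1" and x: "x = norm x *\<^sub>R u" using False by (simp_all add: u_def)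
    have "\<bar>g u\<bar> \<le> c"
      using unit[of u] unit[of "- u"] u by (simp add: blinfun.minus_right)
    moreover have "norm (g x) = norm x * \<bar>g u\<bar>"
      by (subst x) (simp add: blinfun.scaleR_right abs_mult)
    ultimately show ?thesis
      using mult_left_mono[of "\<bar>g u\<bar>" c "norm x"] by (simp add: mult.commute)
  qed simp
  then have "norm g \<le> c"
    using assms by (intro norm_blinfun_bound) auto
  then show False using assms by simp
qed

text \<open>Suppose that the midpoint \<open>m\<close> of \<open>g\<close> and \<open>h\<close> had norm above \<open>R - \<delta>\<close>, and choose a unit vector \<open>y\<close> where
  \<open>m\<close> almost attains its norm. As \<open>m\<close> is near \<open>f\<close>, the value \<open>f y\<close> is near 1, so \<open>y\<close> lies in the slice
  where the norm is uniformly smooth. For a unit vector \<open>z\<close> on which \<open>g - h\<close> is large,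
  \<open>g (y + t z) + h (y - t z)\<close> exceeds \<open>2 * R\<close> by an amount of order \<open>\<epsilon> * t\<close>, whereas smoothness
  bounds the excess by a smaller multiple of \<open>\<epsilon> * t\<close>. The radius \<open>R\<close> is kept variable
  because the bound is going to be iterated with decreasing radii.\<close>
proposition dual_norm_uniformly_convex_near:
  fixes x1 :: "'a::real_normed_vector"
  assumes smooth: "C1plus_loc_smooth_norm TYPE('a)"
    and lur: "LUR_norm TYPE('a)" and x1: "x1 \<noteq> 0"
  obtains f :: "'a \<Rightarrow>\<^sub>L real" and \<eta> where "norm f = 1" "0 < \<eta>" "\<eta> \<le> 1/4"
    "\<And>\<epsilon>. 0 < \<epsilon> \<Longrightarrow> \<exists>\<delta>>0. \<forall>R g h. R \<le> 2 \<longrightarrow> norm g \<le> R \<longrightarrow> norm h \<le> R \<longrightarrow>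
       norm ((g + h) /\<^sub>R 2 - f) \<le> \<eta> \<longrightarrow> \<epsilon> \<le> norm (g - h) \<longrightarrow> norm ((g + h) /\<^sub>R 2) \<le> R - \<delta>"
proof -
  have "norm (x1 /\<^sub>R norm x1) = 1" using x1 by simp
  then obtain x :: 'a where x: "norm x = 1" by blast
  obtain D :: "'a \<Rightarrow> 'a \<Rightarrow>\<^sub>L real"
    where "\<forall>x \<in> sphere 0 1. (norm has_derivative blinfun_apply (D x)) (at x)"
      and unif: "\<forall>x \<in> sphere 0 1. \<exists>U. open U \<and> x \<in> U \<and> uniformly_continuous_on (U \<inter> sphere 0 1) D"
    using smooth unfolding C1plus_loc_smooth_norm_def by blast
  then have D: "\<And>w. norm w = 1 \<Longrightarrow> (norm has_derivative D w) (at w)" by simp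
  obtain U where U: "open U" "x \<in> U" "uniformly_continuous_on (U \<inter> sphere 0 1) D"
    using unif x by (metis dist_0_norm mem_sphere)
  obtain r where r: "0 < r" "ball x r \<subseteq> U"
    using U openE by blast
  have unif_ball: "uniformly_continuous_on (ball x r \<inter> sphere 0 1) D"
    using U(3) r(2) unfolding uniformly_continuous_on_def by (meson IntD1 IntD2 IntI subsetD)
  define f where "f = D x"
  have f: "norm f \<le> 1" "f x = 1"
    using norm_derivative_bounds[OF D[OF x]] x by (auto simp: f_def)
  have f1: "norm f = 1"
    using norm_blinfun[of f x] f x by simp
  obtain \<zeta> where \<zeta>: "0 < \<zeta>" "\<And>y. norm y = 1 \<Longrightarrow> 1 - \<zeta> < f y \<Longrightarrow> dist y x < r / 2"
    using LUR_slices_shrink[OF lur x f, of "r / 2"] r by auto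
  define \<eta> where "\<eta> = min (1/4) (\<zeta> / 3)"
  have \<eta>: "0 < \<eta>" "\<eta> \<le> 1/4" "3 * \<eta> \<le> \<zeta>" using \<zeta>(1) by (auto simp: \<eta>_def)
  show ?thesis
  proof (rule that[OF f1 \<eta>(1,2)])
    fix \<epsilon> :: real assume \<epsilon>: "0 < \<epsilon>"
    obtain t where t: "0 < t"
      and flat: "\<And>y z. norm y = 1 \<Longrightarrow> dist y x < r / 2 \<Longrightarrow> norm z = 1 \<Longrightarrow>
        norm (y + t *\<^sub>R z) + norm (y - t *\<^sub>R z) \<le> 2 + \<epsilon> / 8 * t"
      using derivative_controls_smoothness[OF D unif_ball r(1), of "\<epsilon> / 8"] \<epsilon> by auto
    define \<delta> where "\<delta> = min \<eta> (\<epsilon> * t / 16)"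
    have \<delta>: "0 < \<delta>" "\<delta> \<le> \<eta>" "\<delta> \<le> \<epsilon> * t / 16" using \<epsilon> t \<eta> by (auto simp: \<delta>_def)
    have "norm ((g + h) /\<^sub>R 2) \<le> R - \<delta>"
      if R: "R \<le> 2" and g: "norm g \<le> R" and h: "norm h \<le> R"
        and near: "norm ((g + h) /\<^sub>R 2 - f) \<le> \<eta>" and gap: "\<epsilon> \<le> norm (g - h)"
      for R and g h :: "'a \<Rightarrow>\<^sub>L real"
    proof (rule ccontr)
      let ?m = "(g + h) /\<^sub>R 2"
      assume "\<not> norm ?m \<le> R - \<delta>"
      then have large: "R - \<delta> < norm ?m" by simp
      have "1 - \<eta> \<le> norm ?m"
        using norm_triangle_ineq2[of f ?m] near f1 by (simp add: norm_minus_commute)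
      moreover have "norm ?m \<le> R"
        using norm_triangle_ineq[of g h] g h by simp
      ultimately have R1: "1 - \<eta> \<le> R" by linarith
      then obtain y where y: "norm y = 1" "R - \<delta> < ?m y"
        using almost_norming_vector[OF _ large] \<eta>(2) \<delta>(2) by auto
      have "?m y - f y \<le> \<eta>"
        using norm_blinfun[of "?m - f" y] near y(1) by (simp add: blinfun.diff_left)
      then have "1 - \<zeta> < f y"
        using y(2) R1 \<delta> \<eta> by linarith
      then have close: "dist y x < r / 2"
        using \<zeta>(2) y(1) by blast
      have "0 \<le> \<epsilon> / 2" "\<epsilon> / 2 < norm (g - h)" using \<epsilon> gap by auto
      then obtain z where z: "norm z = 1" "\<epsilon> / 2 < (g - h) z"
        using almost_norming_vector by blast
      have "g (y + t *\<^sub>R z) \<le> R * norm (y + t *\<^sub>R z)"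
        using norm_blinfun[of g "y + t *\<^sub>R z"] mult_right_mono[OF g, of "norm (y + t *\<^sub>R z)"]
        by simp
      moreover have "h (y - t *\<^sub>R z) \<le> R * norm (y - t *\<^sub>R z)"
        using norm_blinfun[of h "y - t *\<^sub>R z"] mult_right_mono[OF h, of "norm (y - t *\<^sub>R z)"]
        by simp
      moreover have "R * (norm (y + t *\<^sub>R z) + norm (y - t *\<^sub>R z)) \<le> R * (2 + \<epsilon> / 8 * t)"
        using flat[OF y(1) close z(1)] R1 \<eta> by (intro mult_left_mono) auto
      moreover have "R * (\<epsilon> / 8 * t) \<le> 2 * (\<epsilon> / 8 * t)"
        using R \<epsilon> t by (intro mult_right_mono) auto
      ultimately have "2 * ?m y + t * (g - h) z \<le> 2 * R + \<epsilon> * t / 4"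
        by (simp add: blinfun.add_right blinfun.diff_right blinfun.add_left blinfun.diff_left
            blinfun.scaleR_left blinfun.scaleR_right algebra_simps)
      moreover have "t * (\<epsilon> / 2) < t * (g - h) z"
        using z(2) t by simp
      ultimately show False
        using y(2) \<delta>(1,3) by (simp add: algebra_simps)
    qed
    then show "\<exists>\<delta>>0. \<forall>R g h. R \<le> 2 \<longrightarrow> norm g \<le> R \<longrightarrow> norm h \<le> R \<longrightarrow>
       norm ((g + h) /\<^sub>R 2 - f) \<le> \<eta> \<longrightarrow> \<epsilon> \<le> norm (g - h) \<longrightarrow> norm ((g + h) /\<^sub>R 2) \<le> R - \<delta>"
      using \<delta>(1) by blast
  qed
qed

section \<open>James systems in the dual of a smooth LUR space\<close>

text \<open>The arithmetic mean of \<open>h i, \<dots>, h (i + 2 ^ l - 1)\<close>, presented as an iterated midpoint because uniform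
  convexity speaks about midpoints.\<close>
primrec dyadic_mean :: "(nat \<Rightarrow> 'a::real_vector) \<Rightarrow> nat \<Rightarrow> nat \<Rightarrow> 'a" where
  "dyadic_mean h 0 i = h i"
| "dyadic_mean h (Suc l) i = (dyadic_mean h l i + dyadic_mean h l (i + 2 ^ l)) /\<^sub>R 2"

lemma dyadic_mean_in_convex:
  assumes "convex S" "\<And>n. i \<le> n \<Longrightarrow> n < i + 2 ^ l \<Longrightarrow> h n \<in> S"
  shows "dyadic_mean h l i \<in> S"
  using assms(2)
proof (induction l arbitrary: i)
  case 0
  then show ?case by simp
next
  case (Suc l)
  have "dyadic_mean h l i \<in> S" "dyadic_mean h l (i + 2 ^ l) \<in> S"
    by (rule Suc.IH; rule Suc.prems; simp)+
  then have "(1/2) *\<^sub>R dyadic_mean h l i + (1/2) *\<^sub>R dyadic_mean h l (i + 2 ^ l) \<in> S"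
    using assms(1) by (intro convexD) auto
  then show ?case by (simp add: scaleR_add_right)
qed

text \<open>The functionals \<open>h i = f + s g i\<close> lie in the ball of radius \<open>\<eta>\<close> around \<open>f\<close>, and so do their means. The
  means \<open>u\<close> and \<open>v\<close> of two adjacent blocks take values at the last vector of the left block that
  differ by \<open>s * (b - a)\<close>, so local uniform convexity applies to them. Hence means over blocks of
  length \<open>2 ^ l\<close> have norm at most \<open>1 + \<eta> - l * \<delta>\<close>; for large \<open>l\<close> this contradicts the lower bound \<open>1 - \<eta>\<close>.\<close>
proposition james_systems_bounded_length:
  fixes x1 :: "'y::real_normed_vector"
  assumes smooth: "C1plus_loc_smooth_norm TYPE('y)" and lur: "LUR_norm TYPE('y)"
    and x1: "x1 \<noteq> 0" and M: "0 < M" and ab: "a < b"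
  obtains N where "\<And>(g :: nat \<Rightarrow> 'y \<Rightarrow>\<^sub>L real) y. \<not> james_system M a b N g y"
proof -
  obtain f :: "'y \<Rightarrow>\<^sub>L real" and \<eta> where f: "norm f = 1" and \<eta>: "0 < \<eta>" "\<eta> \<le> 1/4"
    and convex: "\<And>\<epsilon>. 0 < \<epsilon> \<Longrightarrow> \<exists>\<delta>>0. \<forall>R g h. R \<le> 2 \<longrightarrow> norm g \<le> R \<longrightarrow> norm h \<le> R \<longrightarrow>
       norm ((g + h) /\<^sub>R 2 - f) \<le> \<eta> \<longrightarrow> \<epsilon> \<le> norm (g - h) \<longrightarrow> norm ((g + h) /\<^sub>R 2) \<le> R - \<delta>"
    using dual_norm_uniformly_convex_near[OF smooth lur x1] by blast
  define s where "s = \<eta> / M"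
  have s: "0 < s" "s * M = \<eta>" using \<eta> M by (auto simp: s_def)
  have "0 < s * (b - a) / M" using s ab M by simp
  from convex[OF this] obtain \<delta> where \<delta>: "0 < \<delta>"
    and drop: "\<And>R g h. R \<le> 2 \<Longrightarrow> norm g \<le> R \<Longrightarrow> norm h \<le> R \<Longrightarrow>
       norm ((g + h) /\<^sub>R 2 - f) \<le> \<eta> \<Longrightarrow> s * (b - a) / M \<le> norm (g - h) \<Longrightarrow>
       norm ((g + h) /\<^sub>R 2) \<le> R - \<delta>"
    by blast
  obtain m :: nat where m: "2 * \<eta> < real m * \<delta>"
    using reals_Archimedean3[OF \<delta>] by blast
  have "\<not> james_system M a b (2 ^ m) g y" for g :: "nat \<Rightarrow> 'y \<Rightarrow>\<^sub>L real" and y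
  proof
    assume gy: "james_system M a b (2 ^ m) g y"
    define h where "h i = f + s *\<^sub>R g i" for i
    have near: "dyadic_mean h l i \<in> cball f \<eta>" if "i + 2 ^ l \<le> 2 ^ m" for l i
    proof (rule dyadic_mean_in_convex)
      fix n assume "n < i + 2 ^ l"
      then have "norm (g n) \<le> M" using gy that by (simp add: james_system_def)
      then have "s * norm (g n) \<le> \<eta>" using s mult_left_mono[of "norm (g n)" M s] by simp
      then show "h n \<in> cball f \<eta>" using s by (simp add: h_def dist_norm)
    qed simp
    have "norm (dyadic_mean h l i) \<le> 1 + \<eta> - l * \<delta>" if "i + 2 ^ l \<le> 2 ^ m" for l i
      using that
    proof (induction l arbitrary: i)
      case 0
      then show ?case
        using near[of i 0] norm_triangle_ineq2[of "h i" f] f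
        by (simp add: dist_norm norm_minus_commute)
    next
      case (Suc l)
      let ?u = "dyadic_mean h l i" and ?v = "dyadic_mean h l (i + 2 ^ l)"
      define k where "k = i + 2 ^ l - 1"
      have pos: "(0::nat) < 2 ^ l" by simp
      have k: "k < 2 ^ m" using Suc.prems pos unfolding k_def power_Suc by linarith
      have yk: "norm (y k) \<le> M" using gy k by (simp add: james_system_def)
      have conv_le: "convex {w :: 'y \<Rightarrow>\<^sub>L real. w z \<le> c}" for z c
        unfolding convex_def
        by (auto simp: blinfun.add_left blinfun.scaleR_left intro: convex_bound_le)
      have conv_ge: "convex {w :: 'y \<Rightarrow>\<^sub>L real. c \<le> w z}" for z c
        using conv_le[of "- z" "- c"] by (simp add: blinfun.minus_right)
      have "?u \<in> {w. f (y k) + s * b \<le> blinfun_apply w (y k)}"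
      proof (rule dyadic_mean_in_convex[OF conv_ge])
        fix n assume "i \<le> n" "n < i + 2 ^ l"
        then have "b \<le> g n (y k)" using gy k by (simp add: james_system_def k_def)
        then show "h n \<in> {w. f (y k) + s * b \<le> blinfun_apply w (y k)}"
          using s by (simp add: h_def blinfun.add_left blinfun.scaleR_left)
      qed
      moreover have "?v \<in> {w. blinfun_apply w (y k) \<le> f (y k) + s * a}"
      proof (rule dyadic_mean_in_convex[OF conv_le])
        fix n assume n: "i + 2 ^ l \<le> n" "n < i + 2 ^ l + 2 ^ l"
        then have "k < n" "n < 2 ^ m" using pos Suc.prems unfolding k_def by auto
        then have "g n (y k) \<le> a" using gy k by (simp add: james_system_def)
        then show "h n \<in> {w. blinfun_apply w (y k) \<le> f (y k) + s * a}"
          using s by (simp add: h_def blinfun.add_left blinfun.scaleR_left)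
      qed
      ultimately have "s * (b - a) \<le> (?u - ?v) (y k)"
        by (simp add: blinfun.diff_left algebra_simps)
      also have "\<dots> \<le> norm (?u - ?v) * M"
        using norm_blinfun[of "?u - ?v" "y k"] mult_left_mono[OF yk, of "norm (?u - ?v)"] by simp
      finally have gap: "s * (b - a) / M \<le> norm (?u - ?v)"
        using M by (simp add: field_simps)
      have "norm ((?u + ?v) /\<^sub>R 2) \<le> (1 + \<eta> - l * \<delta>) - \<delta>"
      proof (rule drop[OF _ _ _ _ gap])
        show "1 + \<eta> - l * \<delta> \<le> 2"
          using \<eta> \<delta> by (smt (verit) mult_nonneg_nonneg of_nat_0_le_iff divide_le_eq_1)
        show "norm ?u \<le> 1 + \<eta> - l * \<delta>" "norm ?v \<le> 1 + \<eta> - l * \<delta>"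
          using Suc.prems by (auto intro!: Suc.IH)
        show "norm ((?u + ?v) /\<^sub>R 2 - f) \<le> \<eta>"
          using near[OF Suc.prems] by (simp add: dist_norm norm_minus_commute)
      qed
      then show ?case by (simp add: algebra_simps)
    qed
    from this[of 0 m] have "norm (dyadic_mean h m 0) < 1 - \<eta>"
      using m by simp
    moreover have "1 - \<eta> \<le> norm (dyadic_mean h m 0)"
      using near[of 0 m] norm_triangle_ineq2[of f "dyadic_mean h m 0"] f by (simp add: dist_norm)
    ultimately show False by simp
  qed
  then show ?thesis by (rule that)
qed

section \<open>Super-reflexivity of the completion\<close>

theorem theorem5p2:
  fixes j :: "'y::real_normed_vector \<Rightarrow> 'b::banach"
  assumes infinite_dim: "\<not> finite_dim (UNIV :: 'y set)"
    and smooth: "C1plus_loc_smooth_norm TYPE('y)"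
    and lur: "LUR_norm TYPE('y)"
    and completion: "is_completion j"
    and representable: "finitely_representable TYPE('c::banach) TYPE('b)"
  shows "reflexive TYPE('c)"
proof (rule ccontr)
  assume "\<not> reflexive TYPE('c)"
  then obtain M d :: real where M: "0 < M" and d: "0 < d"
    and long: "\<And>N. \<exists>(g :: nat \<Rightarrow> 'c \<Rightarrow>\<^sub>L real) x. james_system M (d / 4) (3 * d / 4) N g x"
    using nonreflexive_james_systems by blast
  have "\<exists>x :: 'y. x \<noteq> 0"
  proof (rule ccontr)
    assume "\<not> ?thesis"
    then have "span {} = (UNIV :: 'y set)" by auto
    then show False using infinite_dim unfolding finite_dim_def by blast
  qed
  then obtain x1 :: 'y where "x1 \<noteq> 0" by blast
  then obtain N where bounded: "\<And>(g :: nat \<Rightarrow> 'y \<Rightarrow>\<^sub>L real) y.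
      \<not> james_system (2 * M + d / 8) (d / 4 + d / 8) (3 * d / 4 - d / 8) N g y"
    using james_systems_bounded_length[OF smooth lur, of x1 "2 * M + d / 8"
        "d / 4 + d / 8" "3 * d / 4 - d / 8"] M d by auto
  obtain g :: "nat \<Rightarrow> 'c \<Rightarrow>\<^sub>L real" and x where "james_system M (d / 4) (3 * d / 4) N g x"
    using long by blast
  then show False
    using james_system_transfer[OF completion representable, of M _ _ N g x "d / 8"] bounded M d
    by (metis less_eq_real_def zero_less_divide_iff zero_less_numeral)
qed

end
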